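(* Let $n\ge 2$, $1\le h(1)\le n$, $h=(h(1),n,\ldots,n)$, and let $P_h$ be the poset on $[n]$ with $i<_{P_h}j$ iff $h(i)<j$. Let $\mu=(2,1^{n-2})$. Let $B_3$ be the set of formal expressions $x_n^{\ell_1}x_{n-1}^{\ell_2}\cdots x_2^{\ell_{n-1}}(y_k-y_1)$ with $0\le \ell_j\le n-1-j$ for all $j$, $2\le k\le n$, and such that $x_n^{\ell_1}\cdots x_2^{\ell_{n-1}}$ is not divisible by $\prod_{\ell=h(1)+1}^n x_\ell$ (so the exponent of $x_p$ is $\ell_{n+1-p}$ for $2\le p\le n$). Define $\varphi$ on $B_3$ by $\varphi(x_n^{\ell_1}\cdots x_2^{\ell_{n-1}}(y_k-y_1))=(S,T)$, where $S$ is the unique standard Young tableau of shape $\mu$ whose bottom row contains $1$ and $k$, and $T$ is built as follows: let $j$ be the largest element of $\{h(1)+1,\ldots,n\}$ with $\ell_{n+1-j}=0$; start with the bottom row consisting of $1$ (left) and $j$ (right); then for $i=2,3,\ldots,n$ in increasing order with $i\neq j$, insert a new box containing $i$ into the left column (the column whose bottom entry is $1$) so that exactly $(i-2)-\ell_{n+1-i}$ of the entries currently in the left column lie above it. Then $\varphi$ is a well-defined map from $B_3$ to the set of pairs $(S,T)$ with $S$ a standard Young tableau of shape $\mu$ and $T$ a $P_h$-tableau of shape $\mu$, and $\varphi$ is a bijection.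
   Context: Tableaux use the French convention: the Young diagram of $\mu=(2,1^{n-2})$ is a bottom row of two boxes with a column of $n-2$ boxes stacked above the left box. For a poset $P$ on $[n]$, a $P$-tableau of shape $\lambda$ is a filling using each element of $[n]$ exactly once such that if $j$ is directly to the right of $i$ then $j>_P i$, and if $j$ is directly above $i$ then $j\not<_P i$. A standard Young tableau is a $P$-tableau for the total order on $[n]$ (entries increase left to right and bottom to top). *)

theory Defs
  imports "HOL-Library.FuncSet" "HOL-Library.Poly_Mapping"
begin

text \<open>
  Partitions are weakly decreasing lists of positive numbers. Cells are pairs
  (row, column) counted from 0, and row 0 is the bottom row (French convention).
\<close>

definition young_diagram :: "nat list \<Rightarrow> (nat \<times> nat) set" where
  "young_diagram lam = {(r, c). r < length lam \<and> c < lam ! r}"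

definition P_tableaux ::
    "nat \<Rightarrow> (nat \<Rightarrow> nat \<Rightarrow> bool) \<Rightarrow> nat list \<Rightarrow> (nat \<times> nat \<Rightarrow> nat) set" where
  "P_tableaux n less_P lam =
    {T \<in> extensional (young_diagram lam).
       bij_betw T (young_diagram lam) {1..n} \<and>
       (\<forall>r c. (r, c) \<in> young_diagram lam \<longrightarrow> (r, Suc c) \<in> young_diagram lam \<longrightarrow>
          less_P (T (r, c)) (T (r, Suc c))) \<and>
       (\<forall>r c. (r, c) \<in> young_diagram lam \<longrightarrow> (Suc r, c) \<in> young_diagram lam \<longrightarrow>
          \<not> less_P (T (Suc r, c)) (T (r, c)))}"

definition standard_tableaux :: "nat \<Rightarrow> nat list \<Rightarrow> (nat \<times> nat \<Rightarrow> nat) set" where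
  "standard_tableaux n lam = P_tableaux n (<) lam"

definition bottom_row :: "nat list \<Rightarrow> (nat \<times> nat \<Rightarrow> nat) \<Rightarrow> nat set" where
  "bottom_row lam T = {T (0, c) | c. (0, c) \<in> young_diagram lam}"

definition mu :: "nat \<Rightarrow> nat list" where
  "mu n = 2 # replicate (n - 2) 1"

definition less_Ph :: "nat \<Rightarrow> (nat \<Rightarrow> nat) \<Rightarrow> nat \<Rightarrow> nat \<Rightarrow> bool" where
  "less_Ph n h i j \<longleftrightarrow> i \<in> {1..n} \<and> j \<in> {1..n} \<and> h i < j"

lemma less_Ph_strict_order:
  assumes "\<forall>i\<in>{1..n}. i \<le> h i"
  shows "irreflp (less_Ph n h)" and "transp (less_Ph n h)"
proof -
  show "irreflp (less_Ph n h)"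
  proof (rule irreflpI)
    fix i
    show "\<not> less_Ph n h i i"
      using bspec[OF assms, of i] by (auto simp: less_Ph_def)
  qed
  show "transp (less_Ph n h)"
  proof (rule transpI)
    fix i j k
    assume ij: "less_Ph n h i j" and jk: "less_Ph n h j k"
    then have "j \<le> h j"
      using assms by (simp add: less_Ph_def)
    with ij jk show "less_Ph n h i k"
      by (simp add: less_Ph_def)
  qed
qed

text \<open>The variables of the polynomial ring over the integers in countably many variables.\<close>

definition x_var :: "nat \<Rightarrow> (nat \<Rightarrow>\<^sub>0 nat) \<Rightarrow>\<^sub>0 int" where
  "x_var p = Poly_Mapping.single (Poly_Mapping.single p 1) 1"

definition x_monomial :: "nat \<Rightarrow> (nat \<Rightarrow> nat) \<Rightarrow> (nat \<Rightarrow>\<^sub>0 nat) \<Rightarrow>\<^sub>0 int" where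
  "x_monomial n l = (\<Prod>j = 1..n - 1. x_var (n + 1 - j) ^ l j)"

text \<open>
  The formal expression with exponents \<open>l 1, \<dots>, l (n - 1)\<close> and last factor
  \<open>y\<^sub>k - y\<^sub>1\<close> is represented by the pair \<open>(l, k)\<close>; \<open>l\<close> is extensional, so that
  distinct pairs are distinct expressions.
\<close>

definition B3 :: "nat \<Rightarrow> (nat \<Rightarrow> nat) \<Rightarrow> ((nat \<Rightarrow> nat) \<times> nat) set" where
  "B3 n h =
    {(l, k). l \<in> (\<Pi>\<^sub>E j\<in>{1..n - 1}. {0..n - 1 - j}) \<and> k \<in> {2..n} \<and>
       \<not> (\<Prod>p = h 1 + 1..n. x_var p) dvd x_monomial n l}"

definition zero_positions :: "nat \<Rightarrow> (nat \<Rightarrow> nat) \<Rightarrow> (nat \<Rightarrow> nat) \<Rightarrow> nat set" where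
  "zero_positions n h l = {j \<in> {h 1 + 1..n}. l (n + 1 - j) = 0}"

definition last_zero :: "nat \<Rightarrow> (nat \<Rightarrow> nat) \<Rightarrow> (nat \<Rightarrow> nat) \<Rightarrow> nat" where
  "last_zero n h l = Max (zero_positions n h l)"

text \<open>
  Columns are listed from bottom to top. The new entry has exactly \<open>m\<close> entries above it
  provided that \<open>m \<le> length C\<close>.
\<close>

definition insert_below :: "nat \<Rightarrow> nat \<Rightarrow> nat list \<Rightarrow> nat list" where
  "insert_below m i C = take (length C - m) C @ i # drop (length C - m) C"

definition entries_above :: "nat \<Rightarrow> (nat \<Rightarrow> nat) \<Rightarrow> nat \<Rightarrow> nat" where
  "entries_above n l i = (i - 2) - l (n + 1 - i)"

text \<open>The left column after all entries smaller than \<open>i\<close>, except \<open>j\<close>, have been inserted.\<close>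

definition left_column :: "nat \<Rightarrow> (nat \<Rightarrow> nat) \<Rightarrow> nat \<Rightarrow> nat \<Rightarrow> nat list" where
  "left_column n l j i =
    fold (\<lambda>i' C. insert_below (entries_above n l i') i' C) (filter (\<lambda>i'. i' \<noteq> j) [2..<i]) [1]"

definition S_tableau :: "nat \<Rightarrow> nat \<Rightarrow> nat \<times> nat \<Rightarrow> nat" where
  "S_tableau n k = (THE S. S \<in> standard_tableaux n (mu n) \<and> {1, k} \<subseteq> bottom_row (mu n) S)"

definition T_tableau :: "nat \<Rightarrow> (nat \<Rightarrow> nat) \<Rightarrow> (nat \<Rightarrow> nat) \<Rightarrow> nat \<times> nat \<Rightarrow> nat" where
  "T_tableau n h l =
    (let j = last_zero n h l; C = left_column n l j (n + 1)
     in restrict (\<lambda>(r, c). if c = 0 then C ! r else j) (young_diagram (mu n)))"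

definition phi ::
    "nat \<Rightarrow> (nat \<Rightarrow> nat) \<Rightarrow> (nat \<Rightarrow> nat) \<times> nat \<Rightarrow> (nat \<times> nat \<Rightarrow> nat) \<times> (nat \<times> nat \<Rightarrow> nat)" where
  "phi n h = (\<lambda>(l, k). (S_tableau n k, T_tableau n h l))"

end

theory Submission imports Defs
begin

text \<open>
  A tableau of hook shape \<open>\<mu>\<close> is a column \<open>C\<close> together with the entry \<open>j\<close> to the right of its
  bottom box. Standardness forces \<open>C\<close> to be the increasing list of the entries other than \<open>j\<close>, so
  standard tableaux correspond to \<open>j \<in> {2..n}\<close>. As 1 is the only element of the poset below
  anything, a \<open>P\<^sub>h\<close>-tableau is a column starting with 1 and an entry \<open>j > h 1\<close>, with no further
  condition. Such a column arises from \<open>[1]\<close> by inserting the other entries in increasing order.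
  The entry \<open>i\<close> may go to any place above 1: below \<open>j\<close> there are \<open>i - 1\<close> such places, coded by
  \<open>0 \<le> \<ell> \<le> i - 2\<close>; beyond \<open>j\<close> there is one entry less in the column, and the \<open>i - 2\<close> places are
  coded by \<open>1 \<le> \<ell> \<le> i - 2\<close>. Hence \<open>j\<close> can be read off the exponents as the last zero.
\<close>

section \<open>Divisibility of monomials\<close>

lemma x_var_power: "x_var p ^ m = Poly_Mapping.single (Poly_Mapping.single p m) 1"
  by (induction m) (simp_all add: x_var_def mult_single single_add[symmetric] add.commute)

lemma prod_x_var_power:
  "(\<Prod>j\<in>A. x_var (f j) ^ l j)
     = Poly_Mapping.single (\<Sum>j\<in>A. Poly_Mapping.single (f j) (l j)) 1"
  by (induction A rule: infinite_finite_induct) (simp_all add: x_var_power mult_single)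

text \<open>Every exponent vector in the support of \<open>x_var p * q\<close> is a unit vector at
  \<open>p\<close> plus some vector, so its entry at \<open>p\<close> is positive.\<close>

lemma x_var_dvd_singleD:
  assumes "x_var p dvd Poly_Mapping.single e 1"
  shows "Poly_Mapping.lookup e p \<noteq> 0"
proof -
  obtain q where q: "Poly_Mapping.single e (1::int) = x_var p * q"
    using assms by (auto simp: dvd_def)
  have "e \<in> Poly_Mapping.keys (x_var p * q)"
    unfolding q[symmetric] by simp
  then obtain b where "e = Poly_Mapping.single p 1 + b"
    using keys_mult[of "x_var p" q] by (auto simp: x_var_def)
  then show ?thesis
    by (simp add: lookup_add)
qed

text \<open>The product is squarefree, so it divides the monomial precisely when each of its
  variables occurs there, and the exponent of variable \<open>p\<close> is
  \<open>l (n + 1 - p)\<close>. Non-divisibility in \<open>B3\<close> thus means that a last zero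
  exists.\<close>

lemma prod_x_var_dvd_x_monomial_iff:
  assumes "1 \<le> h 1"
  shows "(\<Prod>p = h 1 + 1..n. x_var p) dvd x_monomial n l \<longleftrightarrow> zero_positions n h l = {}"
proof
  assume dvd: "(\<Prod>p = h 1 + 1..n. x_var p) dvd x_monomial n l"
  have "l (n + 1 - p) \<noteq> 0" if p: "p \<in> {h 1 + 1..n}" for p
  proof
    assume l0: "l (n + 1 - p) = 0"
    have "x_var p dvd (\<Prod>p = h 1 + 1..n. x_var p)"
      using p by (intro dvd_prodI) auto
    also note dvd
    finally have "Poly_Mapping.lookup
        (\<Sum>j = 1..n - 1. Poly_Mapping.single (n + 1 - j) (l j)) p \<noteq> 0"
      unfolding x_monomial_def prod_x_var_power by (rule x_var_dvd_singleD)
    then obtain j where "j \<in> {1..n - 1}"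
        "Poly_Mapping.lookup (Poly_Mapping.single (n + 1 - j) (l j)) p \<noteq> 0"
      by (auto simp: lookup_sum)
    then have "n + 1 - j = p" "l j \<noteq> 0" "j = n + 1 - p"
      by (auto simp: lookup_single when_def split: if_splits)
    then show False using l0 by simp
  qed
  then show "zero_positions n h l = {}"
    by (auto simp: zero_positions_def)
next
  assume zp: "zero_positions n h l = {}"
  \<comment> \<open>Indexing by the variable instead of the position lets the products be compared
    factor by factor; \<open>1 \<le> h 1\<close> puts \<open>{h 1 + 1..n}\<close> inside
    \<open>{2..n}\<close>.\<close>
  have "x_monomial n l = (\<Prod>p = 2..n. x_var p ^ l (n + 1 - p))"
    unfolding x_monomial_def
    by (rule prod.reindex_bij_witness[of _ "\<lambda>p. n + 1 - p" "\<lambda>p. n + 1 - p"]) auto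
  moreover have "(\<Prod>p = h 1 + 1..n. x_var p) dvd (\<Prod>p = h 1 + 1..n. x_var p ^ l (n + 1 - p))"
    using zp by (intro prod_dvd_prod) (auto simp: zero_positions_def intro!: dvd_power)
  moreover have "(\<Prod>p = h 1 + 1..n. x_var p ^ l (n + 1 - p)) dvd (\<Prod>p = 2..n. x_var p ^ l (n + 1 - p))"
    using assms by (intro prod_dvd_prod_subset) auto
  ultimately show "(\<Prod>p = h 1 + 1..n. x_var p) dvd x_monomial n l"
    by (simp only:) (rule dvd_trans)
qed

section \<open>Tableaux of hook shape\<close>

lemma mem_young_diagram_mu:
  assumes "2 \<le> n"
  shows "(r, c) \<in> young_diagram (mu n) \<longleftrightarrow> r < n - 1 \<and> c = 0 \<or> r = 0 \<and> c = 1"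
  using assms by (cases r) (auto simp: young_diagram_def mu_def)

text \<open>Normal form of a filling of the shape, with \<open>C\<close> read from bottom to top.
  The restriction makes it extensional, as \<open>P_tableaux\<close> demands, and the body agrees
  with \<open>T_tableau\<close>.\<close>

definition hook :: "nat \<Rightarrow> nat list \<Rightarrow> nat \<Rightarrow> nat \<times> nat \<Rightarrow> nat" where
  "hook n C j = restrict (\<lambda>(r, c). if c = 0 then C ! r else j) (young_diagram (mu n))"

lemma hook_simps:
  assumes "2 \<le> n"
  shows "r < n - 1 \<Longrightarrow> hook n C j (r, 0) = C ! r" and "hook n C j (0, Suc 0) = j"
  using assms by (simp_all add: hook_def mem_young_diagram_mu)

lemma hook_eq_iff:
  assumes "2 \<le> n" "length C = n - 1" "length D = n - 1"
  shows "hook n C j = hook n D k \<longleftrightarrow> C = D \<and> j = k"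
proof
  assume eq: "hook n C j = hook n D k"
  have "C ! r = D ! r" if "r < n - 1" for r
    using hook_simps(1)[OF assms(1) that] eq by metis
  moreover have "j = k"
    using hook_simps(2)[OF assms(1)] eq by metis
  ultimately show "C = D \<and> j = k"
    using assms by (simp add: list_eq_iff_nth_eq)
qed simp

lemma bij_betw_nth_iff:
  "bij_betw ((!) xs) {..<length xs} A \<longleftrightarrow> distinct xs \<and> set xs = A"
  by (auto simp: bij_betw_def inj_on_def distinct_conv_nth set_conv_nth)

text \<open>The map \<open>?g\<close> enumerates the boxes, first the one at the right and then the
  column upwards; along this enumeration the filling is the list \<open>j # C\<close>.\<close>

lemma bij_betw_hook_iff:
  assumes n: "2 \<le> n" and C: "length C = n - 1"
  shows "bij_betw (hook n C j) (young_diagram (mu n)) A \<longleftrightarrow>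
    distinct (j # C) \<and> set (j # C) = A"
proof -
  let ?g = "case_nat (0, 1) (\<lambda>r. (r, 0)) :: nat \<Rightarrow> nat \<times> nat"
  have g: "bij_betw ?g {..<length (j # C)} (young_diagram (mu n))"
    using C n
    by (intro bij_betw_byWitness[where f' = "\<lambda>(r, c). if c = 0 then Suc r else 0"])
       (auto simp: mem_young_diagram_mu split: nat.splits)
  have "bij_betw (hook n C j) (young_diagram (mu n)) A \<longleftrightarrow>
      bij_betw (hook n C j \<circ> ?g) {..<length (j # C)} A"
    by (rule bij_betw_comp_iff[OF g])
  also have "\<dots> \<longleftrightarrow> bij_betw ((!) (j # C)) {..<length (j # C)} A"
    using C n by (intro bij_betw_cong) (auto simp: hook_simps split: nat.splits)
  finally show ?thesis
    by (simp only: bij_betw_nth_iff)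
qed

text \<open>A hook with two bottom boxes has a single horizontal adjacency, and all its vertical
  ones lie in the left column.\<close>

lemma hook_in_P_tableaux_iff:
  assumes n: "2 \<le> n" and C: "length C = n - 1"
  shows "hook n C j \<in> P_tableaux n less_P (mu n) \<longleftrightarrow>
    distinct (j # C) \<and> set (j # C) = {1..n} \<and> less_P (C ! 0) j \<and>
    (\<forall>r. Suc r < length C \<longrightarrow> \<not> less_P (C ! Suc r) (C ! r))"
proof -
  have ext: "hook n C j \<in> extensional (young_diagram (mu n))"
    by (simp add: hook_def)
  have row: "(\<forall>r c. (r, c) \<in> young_diagram (mu n) \<longrightarrow> (r, Suc c) \<in> young_diagram (mu n) \<longrightarrow>
          less_P (hook n C j (r, c)) (hook n C j (r, Suc c))) \<longleftrightarrow> less_P (C ! 0) j"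
    using n by (auto simp: mem_young_diagram_mu hook_simps)
  have col: "(\<forall>r c. (r, c) \<in> young_diagram (mu n) \<longrightarrow> (Suc r, c) \<in> young_diagram (mu n) \<longrightarrow>
          \<not> less_P (hook n C j (Suc r, c)) (hook n C j (r, c))) \<longleftrightarrow>
      (\<forall>r. Suc r < length C \<longrightarrow> \<not> less_P (C ! Suc r) (C ! r))"
    using n C by (auto simp: mem_young_diagram_mu hook_simps)
  show ?thesis
    unfolding P_tableaux_def mem_Collect_eq bij_betw_hook_iff[OF n C] row col
    using ext by blast
qed

lemma P_tableaux_mu_hookE:
  assumes n: "2 \<le> n" and T: "T \<in> P_tableaux n less_P (mu n)"
  obtains C j where "length C = n - 1" "T = hook n C j"
proof
  let ?C = "map (\<lambda>r. T (r, 0)) [0..<n - 1]"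
  show "length ?C = n - 1" by simp
  have ext: "T \<in> extensional (young_diagram (mu n))"
    using T by (simp add: P_tableaux_def)
  show "T = hook n ?C (T (0, 1))"
  proof (rule extensionalityI[OF ext])
    show "hook n ?C (T (0, 1)) \<in> extensional (young_diagram (mu n))"
      by (simp add: hook_def)
    show "T x = hook n ?C (T (0, 1)) x" if "x \<in> young_diagram (mu n)" for x
      using that n by (cases x) (auto simp: mem_young_diagram_mu hook_simps)
  qed
qed

lemma bottom_row_hook:
  assumes "2 \<le> n"
  shows "bottom_row (mu n) (hook n C j) = {C ! 0, j}"
proof -
  have "bottom_row (mu n) (hook n C j) = hook n C j ` {(0, 0), (0, 1)}"
    using assms by (auto simp: bottom_row_def mem_young_diagram_mu)
  then show ?thesis
    using assms by (simp add: hook_simps)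
qed

text \<open>An increasing column is the sorted list of its entries. The row condition excludes
  \<open>j = 1\<close>; conversely, if \<open>j \<ge> 2\<close> then 1 stays in the column and sorts
  to the bottom.\<close>

lemma hook_in_standard_tableaux_iff:
  assumes n: "2 \<le> n" and C: "length C = n - 1"
  shows "hook n C j \<in> standard_tableaux n (mu n) \<longleftrightarrow>
    j \<in> {2..n} \<and> C = sorted_list_of_set ({1..n} - {j})"
proof
  assume "hook n C j \<in> standard_tableaux n (mu n)"
  then have *: "distinct (j # C)" "set (j # C) = {1..n}" "C ! 0 < j"
      "\<forall>r. Suc r < length C \<longrightarrow> C ! r \<le> C ! Suc r"
    by (auto simp: standard_tableaux_def hook_in_P_tableaux_iff[OF n C] not_less)
  have "C ! 0 \<in> set C" using C n by simp
  then have "C ! 0 \<ge> 1" using *(2) by auto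
  then have "j \<in> {2..n}" using *(2,3) by auto
  moreover have "sorted C" using *(4) by (simp add: sorted_iff_nth_Suc)
  moreover have "set C = {1..n} - {j}" using *(1,2) by auto
  ultimately show "j \<in> {2..n} \<and> C = sorted_list_of_set ({1..n} - {j})"
    using *(1) by (metis distinct.simps(2) sorted_list_of_set.idem_if_sorted_distinct)
next
  assume *: "j \<in> {2..n} \<and> C = sorted_list_of_set ({1..n} - {j})"
  then have setC: "set C = {1..n} - {j}" and CD: "distinct C" "sorted C"
    by simp_all
  have "1 \<in> set C"
    unfolding setC using * n by auto
  then obtain r where r: "r < length C" "C ! r = 1"
    by (auto simp: in_set_conv_nth)
  then have "C ! 0 \<le> 1"
    using sorted_nth_mono[OF CD(2), of 0 r] by simp
  then have "C ! 0 < j" using * by auto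
  moreover have "\<forall>r. Suc r < length C \<longrightarrow> \<not> C ! Suc r < C ! r"
    using CD(2) by (simp add: sorted_iff_nth_Suc not_less)
  ultimately show "hook n C j \<in> standard_tableaux n (mu n)"
    unfolding standard_tableaux_def hook_in_P_tableaux_iff[OF n C]
    using * setC CD(1) by auto
qed

section \<open>Standard tableaux indexed by their second bottom entry\<close>

definition standard_hook :: "nat \<Rightarrow> nat \<Rightarrow> nat \<times> nat \<Rightarrow> nat" where
  "standard_hook n k = hook n (sorted_list_of_set ({1..n} - {k})) k"

lemma bij_betw_standard_hook:
  assumes n: "2 \<le> n"
  shows "bij_betw (standard_hook n) {2..n} (standard_tableaux n (mu n))"
proof (rule bij_betw_imageI)
  have len: "length (sorted_list_of_set ({1..n} - {k})) = n - 1" if "k \<in> {2..n}" for k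
    using that by simp
  show "inj_on (standard_hook n) {2..n}"
    using hook_eq_iff[OF n len len] by (auto simp: inj_on_def standard_hook_def)
  show "standard_hook n ` {2..n} = standard_tableaux n (mu n)"
  proof (intro equalityI subsetI)
    show "S \<in> standard_tableaux n (mu n)" if "S \<in> standard_hook n ` {2..n}" for S
      using that hook_in_standard_tableaux_iff[OF n len] by (auto simp: standard_hook_def)
    fix S assume S: "S \<in> standard_tableaux n (mu n)"
    then obtain C j where C: "length C = n - 1" and S_eq: "S = hook n C j"
      using P_tableaux_mu_hookE[OF n] unfolding standard_tableaux_def by metis
    with S show "S \<in> standard_hook n ` {2..n}"
      using hook_in_standard_tableaux_iff[OF n C] by (auto simp: standard_hook_def)
  qed
qed

lemma bottom_row_standard_hook:
  assumes n: "2 \<le> n" and k: "k \<in> {2..n}"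
  shows "bottom_row (mu n) (standard_hook n k) = {1, k}"
proof -
  let ?C = "sorted_list_of_set ({1..n} - {k})"
  have "{1..n} - {k} = insert 1 ({2..n} - {k})"
    using k by auto
  moreover have "sorted_list_of_set (insert 1 ({2..n} - {k})) = 1 # sorted_list_of_set ({2..n} - {k})"
    by (subst sorted_list_of_set_insert) (auto simp: insort_is_Cons)
  ultimately have "?C ! 0 = 1" by simp
  then show ?thesis
    by (simp add: standard_hook_def bottom_row_hook[OF n])
qed

text \<open>The bottom row of a standard tableau is \<open>{1, j}\<close>, so a second element
  \<open>k \<noteq> 1\<close> in it must be \<open>j\<close>. This uniqueness gives the description
  in \<open>S_tableau\<close> its value.\<close>

lemma standard_tableau_bottom_row_iff:
  assumes n: "2 \<le> n" and k: "k \<in> {2..n}"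
  shows "S \<in> standard_tableaux n (mu n) \<and> {1, k} \<subseteq> bottom_row (mu n) S \<longleftrightarrow> S = standard_hook n k"
proof
  assume *: "S \<in> standard_tableaux n (mu n) \<and> {1, k} \<subseteq> bottom_row (mu n) S"
  then obtain j where j: "j \<in> {2..n}" "S = standard_hook n j"
    using bij_betw_imp_surj_on[OF bij_betw_standard_hook[OF n]] by blast
  then have "k \<in> {1, j}"
    using * bottom_row_standard_hook[OF n j(1)] by auto
  then show "S = standard_hook n k"
    using j k by auto
next
  assume "S = standard_hook n k"
  then show "S \<in> standard_tableaux n (mu n) \<and> {1, k} \<subseteq> bottom_row (mu n) S"
    using bij_betwE[OF bij_betw_standard_hook[OF n]] k bottom_row_standard_hook[OF n k] by auto
qed

lemma S_tableau_eq:
  assumes "2 \<le> n" "k \<in> {2..n}"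
  shows "S_tableau n k = standard_hook n k"
  unfolding S_tableau_def standard_tableau_bottom_row_iff[OF assms] by simp

text \<open>As \<open>h i = n\<close> for \<open>i \<ge> 2\<close>, only 1 lies below anything. The
  row condition therefore puts 1 at the bottom, and the column condition only forbids a 1 higher up,
  which distinctness excludes.\<close>

lemma hook_in_Ph_tableaux_iff:
  assumes n: "2 \<le> n" and h: "1 \<le> h 1" "\<forall>i\<in>{2..n}. h i = n" and C: "length C = n - 1"
  shows "hook n C j \<in> P_tableaux n (less_Ph n h) (mu n) \<longleftrightarrow>
    j \<in> {h 1 + 1..n} \<and> distinct C \<and> set C = {1..n} - {j} \<and> hd C = 1"
proof -
  have ne: "C \<noteq> []" using C n by auto
  then have C0: "C ! 0 = hd C" by (simp add: hd_conv_nth)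
  have less: "less_Ph n h a b \<longleftrightarrow> a = 1 \<and> b \<in> {h 1 + 1..n}" for a b
  proof (cases "a \<in> {2..n}")
    case True
    then show ?thesis using h by (auto simp: less_Ph_def)
  next
    case False
    then have "a \<in> {1..n} \<longleftrightarrow> a = 1" using n by auto
    then show ?thesis by (auto simp: less_Ph_def)
  qed
  have col: "C ! Suc r \<noteq> 1" if "distinct C" "hd C = 1" "Suc r < length C" for r
    using that ne C0 nth_eq_iff_index_eq[of C "Suc r" 0] by auto
  show ?thesis
    unfolding hook_in_P_tableaux_iff[OF n C] less C0
    using col by auto
qed

section \<open>Columns built by insertion\<close>

lemma left_column_2: "left_column n l j 2 = [1]"
  by (simp add: left_column_def)

lemma left_column_Suc:
  assumes "2 \<le> i"
  shows "left_column n l j (Suc i) =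
    (if i = j then left_column n l j i
     else insert_below (entries_above n l i) i (left_column n l j i))"
  using assms by (simp add: left_column_def)

text \<open>Insertion reads only the exponents of the inserted entries. The surjectivity proofs use
  this to reset the exponent at \<open>i\<close> or at \<open>j\<close>.\<close>

lemma left_column_cong:
  assumes "\<And>p. p \<in> {2..<i} - {j} \<Longrightarrow> l (n + 1 - p) = l' (n + 1 - p)"
  shows "left_column n l j i = left_column n l' j i"
  unfolding left_column_def using assms
  by (intro fold_cong) (auto simp: entries_above_def)

text \<open>What makes the insertions before \<open>i\<close> legitimate for a fixed
  \<open>j\<close>. Beyond \<open>j\<close> the column has only \<open>p - 2\<close> entries, so
  exponent 0 would place \<open>p\<close> below the 1.\<close>

definition admissible :: "nat \<Rightarrow> (nat \<Rightarrow> nat) \<Rightarrow> nat \<Rightarrow> nat \<Rightarrow> bool" where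
  "admissible n l j i \<longleftrightarrow>
    (\<forall>p\<in>{2..<i} - {j}. l (n + 1 - p) \<le> p - 2 \<and> (j < p \<longrightarrow> 0 < l (n + 1 - p)))"

lemma admissible_Suc:
  assumes "2 \<le> i"
  shows "admissible n l j (Suc i) \<longleftrightarrow> admissible n l j i \<and>
    (i = j \<or> l (n + 1 - i) \<le> i - 2 \<and> (j < i \<longrightarrow> 0 < l (n + 1 - i)))"
  using assms by (auto simp: admissible_def less_Suc_eq)

definition columns :: "nat \<Rightarrow> nat \<Rightarrow> nat list set" where
  "columns j i = {C. distinct C \<and> set C = {1..<i} - {j} \<and> hd C = 1}"

lemma length_column:
  assumes "C \<in> columns j i" "1 \<le> j"
  shows "length C = (if j < i then i - 2 else i - 1)"
proof -
  have "length C = card ({1..<i} - {j})"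
    using assms by (auto simp: columns_def distinct_card[symmetric])
  then show ?thesis using assms by (auto simp: card_Diff_singleton_if)
qed

section \<open>A single insertion\<close>

lemma set_insert_below: "set (insert_below m i C) = insert i (set C)"
proof -
  have "set (insert_below m i C) = insert i (set (take (length C - m) C @ drop (length C - m) C))"
    unfolding insert_below_def set_append list.set by blast
  then show ?thesis by simp
qed

lemma distinct_insert_below:
  "distinct (insert_below m i C) \<longleftrightarrow> i \<notin> set C \<and> distinct C"
proof -
  have "distinct (insert_below m i C) \<longleftrightarrow>
      distinct (i # (take (length C - m) C @ drop (length C - m) C))"
    unfolding insert_below_def by (auto simp del: append_take_drop_id)
  then show ?thesis by simp
qed

text \<open>The entry \<open>i\<close> occurs once and marks its own place, so the parts below and
  above it are determined. The bounds on \<open>m\<close> and \<open>m'\<close> make these the true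
  numbers of entries above.\<close>

lemma insert_below_eq_iff:
  assumes "i \<notin> set C" "i \<notin> set D" "m \<le> length C" "m' \<le> length D"
  shows "insert_below m i C = insert_below m' i D \<longleftrightarrow> m = m' \<and> C = D"
proof
  assume eq: "insert_below m i C = insert_below m' i D"
  have "take (length C - m) C = take (length D - m') D \<and> drop (length C - m) C = drop (length D - m') D"
    using eq assms(1,2) unfolding insert_below_def
    by (subst (asm) append_Cons_eq_iff) (auto dest: in_set_takeD in_set_dropD)
  then have "C = D" "length (drop (length C - m) C) = length (drop (length D - m') D)"
    by (metis append_take_drop_id)+
  then show "m = m' \<and> C = D"
    using assms(3,4) by simp
qed simp

text \<open>For \<open>i < j\<close> the column has \<open>i - 1\<close> entries and at most
  \<open>i - 2\<close> go above; for \<open>i > j\<close> it has \<open>i - 2\<close>, and the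
  positive exponent leaves at most \<open>i - 3\<close>. Strictness keeps 1 at the bottom.\<close>

lemma entries_above_less_length:
  assumes "C \<in> columns j i" "2 \<le> i" "2 \<le> j" "i \<noteq> j" "admissible n l j (Suc i)"
  shows "entries_above n l i < length C"
proof -
  have "j < i \<longrightarrow> 0 < l (n + 1 - i) \<and> l (n + 1 - i) \<le> i - 2"
    using assms(2,4,5) by (auto simp: admissible_Suc)
  then show ?thesis
    using length_column[OF assms(1)] assms(2-4) by (auto simp: entries_above_def)
qed

lemma left_column_in_columns:
  assumes "2 \<le> i" "2 \<le> j" "admissible n l j i"
  shows "left_column n l j i \<in> columns j i"
  using assms(1,3)
proof (induction i rule: dec_induct)
  case base
  show ?case using assms(2) by (auto simp: left_column_2 columns_def)
next
  case (step i)
  let ?C = "left_column n l j i"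
  have C: "?C \<in> columns j i"
    using step by (simp add: admissible_Suc)
  show ?case
  proof (cases "i = j")
    case True
    then show ?thesis using C step.hyps by (auto simp: left_column_Suc columns_def)
  next
    case False
    let ?m = "entries_above n l i"
    have m: "?m < length ?C"
      by (rule entries_above_less_length[OF C step.hyps(1) assms(2) False step.prems])
    \<comment> \<open>The strict bound leaves at least one entry below the new one, so the head is
      unchanged.\<close>
    have "take (length ?C - ?m) ?C \<noteq> []"
      using m by auto
    then have "hd (insert_below ?m i ?C) = hd ?C"
      using m by (simp add: insert_below_def hd_append)
    moreover have "insert i ({1..<i} - {j}) = {1..<Suc i} - {j}"
      using False step.hyps by auto
    ultimately show ?thesis
      using C False step.hyps
      by (simp add: left_column_Suc columns_def set_insert_below distinct_insert_below)
  qed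
qed

text \<open>Insertions can be undone from the largest entry downwards: its place gives its exponent,
  and deleting it gives the previous column.\<close>

lemma left_column_inj:
  assumes "2 \<le> i" "2 \<le> j" "admissible n l j i" "admissible n l' j i"
    and "left_column n l j i = left_column n l' j i"
  shows "\<forall>p\<in>{2..<i} - {j}. l (n + 1 - p) = l' (n + 1 - p)"
  using assms(1,3-5)
proof (induction i rule: dec_induct)
  case base
  show ?case by simp
next
  case (step i)
  have adm: "admissible n l j i" "admissible n l' j i"
    using step by (simp_all add: admissible_Suc)
  let ?C = "left_column n l j i" and ?C' = "left_column n l' j i"
  have C: "?C \<in> columns j i" "?C' \<in> columns j i"
    using adm step.hyps assms(2) by (auto intro: left_column_in_columns)
  show ?case
  proof (cases "i = j")
    case True
    then show ?thesis using step adm by (auto simp: left_column_Suc less_Suc_eq)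
  next
    case False
    have "insert_below (entries_above n l i) i ?C = insert_below (entries_above n l' i) i ?C'"
      using step.prems(3) step.hyps False by (simp add: left_column_Suc)
    then have "entries_above n l i = entries_above n l' i \<and> ?C = ?C'"
      using C entries_above_less_length[OF C(1) step.hyps(1) assms(2) False step.prems(1)]
        entries_above_less_length[OF C(2) step.hyps(1) assms(2) False step.prems(2)]
      by (subst (asm) insert_below_eq_iff) (auto simp: columns_def)
    \<comment> \<open>The truncated subtraction in \<open>entries_above\<close> is injective only on
      exponents up to \<open>i - 2\<close>.\<close>
    moreover have "l (n + 1 - i) \<le> i - 2" "l' (n + 1 - i) \<le> i - 2"
      using step.prems False step.hyps by (simp_all add: admissible_Suc)
    ultimately have "l (n + 1 - i) = l' (n + 1 - i)" "?C = ?C'"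
      unfolding entries_above_def by linarith+
    then show ?thesis
      using step.IH[OF adm] by (auto simp: less_Suc_eq)
  qed
qed

text \<open>Delete the largest entry, obtain exponents for the remaining column by induction, and
  choose the exponent of the deleted entry from its place.\<close>

lemma left_column_surj:
  assumes "2 \<le> i" "2 \<le> j" "i \<le> n + 1" "C \<in> columns j i"
  shows "\<exists>l. admissible n l j i \<and> left_column n l j i = C"
  using assms(1,3,4)
proof (induction i arbitrary: C rule: dec_induct)
  case base
  have "{1..<2} - {j} = {1}"
    using assms(2) by auto
  then have C: "distinct C" "set C = {1}"
    using base.prems by (simp_all add: columns_def)
  then have "length C = 1"
    using distinct_card[of C] by simp
  then have "C = [1]"
    using C(2) by (cases C) simp_all
  then show ?case
    by (auto simp: left_column_2 admissible_def)
next
  case (step i)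
  show ?case
  proof (cases "i = j")
    case True
    have "{1..<Suc i} - {j} = {1..<i} - {j}"
      using True by auto
    then have "C \<in> columns j i"
      using step.prems(2) by (simp add: columns_def)
    then obtain l where "admissible n l j i" "left_column n l j i = C"
      using step.IH[of C] step.prems(1) by auto
    then show ?thesis
      using True step.hyps by (auto simp: admissible_Suc left_column_Suc)
  next
    case False
    have dC: "distinct C" and hC: "hd C = 1" and sC: "set C = {1..<Suc i} - {j}"
      using step.prems(2) by (simp_all add: columns_def)
    have "i \<in> set C"
      unfolding sC using False step.hyps by simp
    then obtain A B where AB: "C = A @ i # B"
      by (meson split_list)
    have A: "A \<noteq> []" using hC AB step.hyps by auto
    have "set (A @ B) = set C - {i}"
      using dC unfolding AB by auto
    also have "\<dots> = {1..<i} - {j}"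
      unfolding sC by auto
    finally have D: "A @ B \<in> columns j i"
      using dC hC A unfolding AB columns_def by simp
    then obtain l where l: "admissible n l j i" "left_column n l j i = A @ B"
      using step.IH[of "A @ B"] step.prems(1) by auto
    have len: "length A + length B = (if j < i then i - 2 else i - 1)"
      using length_column[OF D] assms(2) by simp
    \<comment> \<open>The solution of \<open>(i - 2) - ?v = length B\<close>, where
      \<open>length A + length B\<close> is \<open>i - 2\<close> or \<open>i - 1\<close>. Since 1
      stands before \<open>i\<close>, \<open>A\<close> is nonempty: this gives the positivity
      required beyond \<open>j\<close> and avoids truncation in the other case.\<close>
    let ?v = "if j < i then length A else length A - 1"
    let ?l = "l(n + 1 - i := ?v)"
    \<comment> \<open>Here \<open>i \<le> n\<close>, so the subtractions do not truncate and the
      positions for \<open>p < i\<close> differ from the updated one.\<close>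
    have old: "?l (n + 1 - p) = l (n + 1 - p)" if "p \<in> {2..<i} - {j}" for p
      using that step.prems(1) by auto
    have "admissible n ?l j i"
      using l(1) old unfolding admissible_def by metis
    moreover have "0 < length A" using A by simp
    ultimately have "admissible n ?l j (Suc i)"
      using len step.hyps by (auto simp: admissible_Suc)
    moreover have "left_column n ?l j i = A @ B"
      using left_column_cong[of i j ?l n l] old l(2) by auto
    moreover have "entries_above n ?l i = length B"
      using len \<open>0 < length A\<close> False by (auto simp: entries_above_def)
    ultimately show ?thesis
      using AB False step.hyps
      by (intro exI[of _ ?l])
         (simp add: left_column_Suc[of i] insert_below_def del: fun_upd_apply split del: if_split)
  qed
qed

section \<open>The bijection\<close>

definition exponents :: "nat \<Rightarrow> (nat \<Rightarrow> nat) \<Rightarrow> (nat \<Rightarrow> nat) set" where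
  "exponents n h = {l \<in> (\<Pi>\<^sub>E j\<in>{1..n - 1}. {0..n - 1 - j}). zero_positions n h l \<noteq> {}}"

text \<open>The divisibility condition does not involve \<open>k\<close>, so \<open>B3\<close>
  splits as a product.\<close>

lemma B3_eq:
  assumes "1 \<le> h 1"
  shows "B3 n h = exponents n h \<times> {2..n}"
  unfolding B3_def exponents_def prod_x_var_dvd_x_monomial_iff[of h, OF assms] by auto

section \<open>Exponents and their last zero\<close>

lemma exponent_le:
  assumes "l \<in> exponents n h" "p \<in> {2..n}"
  shows "l (n + 1 - p) \<le> p - 2"
proof -
  have "n + 1 - p \<in> {1..n - 1}" using assms(2) by auto
  then have "l (n + 1 - p) \<in> {0..n - 1 - (n + 1 - p)}"
    using assms(1) by (auto simp: exponents_def PiE_iff)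
  then show ?thesis using assms(2) by auto
qed

lemma last_zero_eq_iff:
  assumes "l \<in> exponents n h"
  shows "last_zero n h l = j \<longleftrightarrow>
    j \<in> {h 1 + 1..n} \<and> l (n + 1 - j) = 0 \<and> (\<forall>p\<in>{j<..n}. 0 < l (n + 1 - p))"
proof -
  have fin: "finite (zero_positions n h l)"
    by (simp add: zero_positions_def)
  have "zero_positions n h l \<noteq> {}"
    using assms by (simp add: exponents_def)
  then have "last_zero n h l = j \<longleftrightarrow> j \<in> zero_positions n h l \<and> (\<forall>p\<in>zero_positions n h l. p \<le> j)"
    unfolding last_zero_def by (rule Max_eq_iff[OF fin])
  also have "\<dots> \<longleftrightarrow> j \<in> {h 1 + 1..n} \<and> l (n + 1 - j) = 0 \<and> (\<forall>p\<in>{j<..n}. 0 < l (n + 1 - p))"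
  proof -
    have "(\<forall>p\<in>zero_positions n h l. p \<le> j) \<longleftrightarrow> (\<forall>p\<in>{j<..n}. l (n + 1 - p) \<noteq> 0)"
      if "j \<in> {h 1 + 1..n}"
    proof -
      \<comment> \<open>For \<open>p > j\<close> the bound \<open>p > h 1\<close> is automatic, so
        maximality says that all exponents beyond \<open>j\<close> are positive, as in
        \<open>admissible\<close>.\<close>
      have "p \<in> zero_positions n h l \<and> \<not> p \<le> j \<longleftrightarrow> p \<in> {j<..n} \<and> l (n + 1 - p) = 0" for p
        unfolding zero_positions_def using that by auto
      then show ?thesis by metis
    qed
    then show ?thesis
      by (auto simp: zero_positions_def)
  qed
  finally show ?thesis .
qed

lemma admissible_last_zero:
  assumes "l \<in> exponents n h" "i \<le> n + 1"
  shows "admissible n l (last_zero n h l) i"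
  using assms exponent_le[OF assms(1)] last_zero_eq_iff[OF assms(1), of "last_zero n h l"]
  by (auto simp: admissible_def)

lemma last_zero_ge_2:
  assumes "l \<in> exponents n h" "1 \<le> h 1"
  shows "2 \<le> last_zero n h l"
  using last_zero_eq_iff[OF assms(1), of "last_zero n h l"] assms(2) by simp

lemma T_tableau_eq:
  "T_tableau n h l = hook n (left_column n l (last_zero n h l) (n + 1)) (last_zero n h l)"
  by (simp add: T_tableau_def hook_def Let_def)

text \<open>A tableau shows \<open>j\<close> and the column; the column determines the exponents at
  all entries other than \<open>j\<close>, and the exponent at \<open>j\<close> is 0 because
  \<open>j\<close> is the last zero.\<close>

lemma bij_betw_T_tableau:
  assumes n: "2 \<le> n" and h: "1 \<le> h 1" "\<forall>i\<in>{2..n}. h i = n"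
  shows "bij_betw (T_tableau n h) (exponents n h) (P_tableaux n (less_Ph n h) (mu n))"
proof (rule bij_betw_imageI)
  let ?j = "last_zero n h" and ?C = "\<lambda>l. left_column n l (last_zero n h l) (n + 1)"
  have j: "?j l \<in> {h 1 + 1..n}" "l (n + 1 - ?j l) = 0" if "l \<in> exponents n h" for l
    using last_zero_eq_iff[OF that, of "?j l"] by auto
  have C: "?C l \<in> columns (?j l) (n + 1)" if "l \<in> exponents n h" for l
    using n that h admissible_last_zero last_zero_ge_2 by (intro left_column_in_columns) auto
  have len: "length D = n - 1" if "D \<in> columns k (n + 1)" "k \<in> {h 1 + 1..n}" for D k
    using length_column[OF that(1)] that(2) by auto
  have col: "D \<in> columns k (n + 1) \<longleftrightarrow> distinct D \<and> set D = {1..n} - {k} \<and> hd D = 1" for D k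
    by (simp add: columns_def atLeastLessThanSuc_atLeastAtMost)
  show "inj_on (T_tableau n h) (exponents n h)"
  proof (rule inj_onI)
    fix l l' assume l: "l \<in> exponents n h" and l': "l' \<in> exponents n h"
      and "T_tableau n h l = T_tableau n h l'"
    then have eq: "?C l = ?C l'" "?j l = ?j l'"
      using hook_eq_iff[OF n len[OF C j(1)] len[OF C j(1)], of l l'] by (auto simp: T_tableau_eq)
    have *: "\<forall>p\<in>{2..<n + 1} - {?j l}. l (n + 1 - p) = l' (n + 1 - p)"
      using n l l' eq admissible_last_zero[OF l, of "n + 1"] admissible_last_zero[OF l', of "n + 1"]
        last_zero_ge_2[OF l h(1)]
      by (intro left_column_inj) auto
    \<comment> \<open>At the common last zero, which the column does not record, both exponents
      vanish.\<close>
    have **: "l (n + 1 - p) = l' (n + 1 - p)" if "p \<in> {2..n}" for p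
      using * that j(2)[OF l] j(2)[OF l'] eq(2) by (cases "p = ?j l") auto
    have "l q = l' q" if "q \<in> {1..n - 1}" for q
    proof -
      have "n + 1 - q \<in> {2..n}" "n + 1 - (n + 1 - q) = q"
        using that by auto
      then show ?thesis using **[of "n + 1 - q"] by simp
    qed
    then show "l = l'"
      using l l' by (intro PiE_ext[of l "{1..n - 1}" "\<lambda>j. {0..n - 1 - j}" l']) (auto simp: exponents_def)
  qed
  show "T_tableau n h ` exponents n h = P_tableaux n (less_Ph n h) (mu n)"
  proof (intro equalityI subsetI)
    fix T assume "T \<in> T_tableau n h ` exponents n h"
    then obtain l where l: "l \<in> exponents n h" and T: "T = hook n (?C l) (?j l)"
      by (auto simp: T_tableau_eq)
    show "T \<in> P_tableaux n (less_Ph n h) (mu n)"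
      unfolding T hook_in_Ph_tableaux_iff[of n h, OF n h len[OF C[OF l] j(1)[OF l]]]
      using j(1)[OF l] C[OF l] unfolding col by simp
  next
    fix T assume T: "T \<in> P_tableaux n (less_Ph n h) (mu n)"
    then obtain D k where D: "length D = n - 1" and T_eq: "T = hook n D k"
      using P_tableaux_mu_hookE[OF n] by metis
    then have k: "k \<in> {h 1 + 1..n}" and "D \<in> columns k (n + 1)"
      using T hook_in_Ph_tableaux_iff[of n h, OF n h D] unfolding col by auto
    then obtain l where l: "admissible n l k (n + 1)" "left_column n l k (n + 1) = D"
      using left_column_surj[of "n + 1" k n D] n h by auto
    \<comment> \<open>The exponents found for \<open>D\<close> are arbitrary at \<open>k\<close>.
      Setting that one to 0 makes \<open>k\<close> a zero, and admissibility makes it the last; the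
      restriction makes \<open>l'\<close> extensional.\<close>
    define l' where "l' = restrict (l(n + 1 - k := 0)) {1..n - 1}"
    have l'_eq: "l' (n + 1 - p) = (if p = k then 0 else l (n + 1 - p))" if "p \<in> {2..n}" for p
      using that k by (auto simp: l'_def)
    have "l' q \<le> n - 1 - q" if "q \<in> {1..n - 1}" for q
    proof -
      let ?p = "n + 1 - q"
      have p: "?p \<in> {2..n}" "n + 1 - ?p = q" "?p - 2 = n - 1 - q"
        using that by auto
      have "l q \<le> n - 1 - q" if "?p \<noteq> k"
      proof -
        have "?p \<in> {2..<n + 1} - {k}" using p(1) that by auto
        then show ?thesis using l(1) p(2,3) unfolding admissible_def by metis
      qed
      then show ?thesis
        using l'_eq[OF p(1)] p(2) by auto
    qed
    then have "l' \<in> (\<Pi>\<^sub>E j\<in>{1..n - 1}. {0..n - 1 - j})"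
      by (auto simp: l'_def)
    moreover have l'k: "l' (n + 1 - k) = 0"
      using l'_eq[of k] k h(1) by auto
    ultimately have l'_mem: "l' \<in> exponents n h"
      using k by (auto simp: exponents_def zero_positions_def)
    moreover have "?j l' = k"
      unfolding last_zero_eq_iff[OF l'_mem]
      using k l'k l'_eq l(1) h(1) by (auto simp: admissible_def)
    moreover have "left_column n l' k (n + 1) = D"
      unfolding l(2)[symmetric] by (rule left_column_cong) (use l'_eq in auto)
    ultimately show "T \<in> T_tableau n h ` exponents n h"
      using T_eq by (intro image_eqI[of _ _ l']) (simp_all add: T_tableau_eq)
  qed
qed

theorem theoremC:
  fixes n :: nat and h :: "nat \<Rightarrow> nat"
  assumes "2 \<le> n" and "1 \<le> h 1" and "h 1 \<le> n" and "\<forall>i\<in>{2..n}. h i = n"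
  shows "(\<forall>(l, k)\<in>B3 n h.
            (\<exists>!S. S \<in> standard_tableaux n (mu n) \<and> {1, k} \<subseteq> bottom_row (mu n) S) \<and>
            zero_positions n h l \<noteq> {} \<and>
            (\<forall>i\<in>{2..n} - {last_zero n h l}.
               l (n + 1 - i) \<le> i - 2 \<and>
               hd (left_column n l (last_zero n h l) i) = 1 \<and>
               entries_above n l i \<le> length (left_column n l (last_zero n h l) i))) \<and>
         phi n h \<in> B3 n h \<rightarrow> standard_tableaux n (mu n) \<times> P_tableaux n (less_Ph n h) (mu n) \<and>
         bij_betw (phi n h) (B3 n h)
           (standard_tableaux n (mu n) \<times> P_tableaux n (less_Ph n h) (mu n))"
proof -
  note B3 = B3_eq[of h n, OF assms(2)]
  have S: "bij_betw (S_tableau n) {2..n} (standard_tableaux n (mu n))"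
    using bij_betw_standard_hook[OF assms(1)]
      bij_betw_cong[OF S_tableau_eq[OF assms(1)], of "{2..n}"] by simp
  note T = bij_betw_T_tableau[of n h, OF assms(1,2,4)]
  \<comment> \<open>Elements of \<open>B3\<close> list the exponents before \<open>k\<close>,
    whereas \<open>phi\<close> puts the tableau of \<open>k\<close> first; hence the swap.\<close>
  have "bij_betw (map_prod (S_tableau n) (T_tableau n h) \<circ> prod.swap) (exponents n h \<times> {2..n})
      (standard_tableaux n (mu n) \<times> P_tableaux n (less_Ph n h) (mu n))"
    by (rule bij_betw_trans[OF _ bij_betw_map_prod[OF S T]])
       (auto simp: bij_betw_def product_swap)
  moreover have "map_prod (S_tableau n) (T_tableau n h) \<circ> prod.swap = phi n h"
    by (auto simp: phi_def)
  ultimately have bij: "bij_betw (phi n h) (B3 n h)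
      (standard_tableaux n (mu n) \<times> P_tableaux n (less_Ph n h) (mu n))"
    by (simp add: B3)
  \<comment> \<open>Well-definedness: \<open>THE\<close> and \<open>Max\<close> have genuine values,
    the subtraction in \<open>entries_above\<close> does not truncate, and each insertion finds
    enough entries in a column with bottom 1.\<close>
  have "(\<exists>!S. S \<in> standard_tableaux n (mu n) \<and> {1, k} \<subseteq> bottom_row (mu n) S) \<and>
      zero_positions n h l \<noteq> {} \<and>
      (\<forall>i\<in>{2..n} - {last_zero n h l}.
         l (n + 1 - i) \<le> i - 2 \<and>
         hd (left_column n l (last_zero n h l) i) = 1 \<and>
         entries_above n l i \<le> length (left_column n l (last_zero n h l) i))"
    if l: "l \<in> exponents n h" and k: "k \<in> {2..n}" for l k
  proof (intro conjI ballI)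
    show "\<exists>!S. S \<in> standard_tableaux n (mu n) \<and> {1, k} \<subseteq> bottom_row (mu n) S"
      unfolding standard_tableau_bottom_row_iff[OF assms(1) k] by simp
    show "zero_positions n h l \<noteq> {}"
      using l by (simp add: exponents_def)
    fix i assume i: "i \<in> {2..n} - {last_zero n h l}"
    then show "l (n + 1 - i) \<le> i - 2"
      using exponent_le[OF l] by simp
    have j: "2 \<le> last_zero n h l"
      by (rule last_zero_ge_2[of l n h, OF l assms(2)])
    have C: "left_column n l (last_zero n h l) i \<in> columns (last_zero n h l) i"
      using i j l by (intro left_column_in_columns admissible_last_zero) auto
    then show "hd (left_column n l (last_zero n h l) i) = 1"
      by (simp add: columns_def)
    show "entries_above n l i \<le> length (left_column n l (last_zero n h l) i)"
      using entries_above_less_length[OF C _ j _ admissible_last_zero[OF l]] i by auto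
  qed
  then show ?thesis
    using bij bij_betw_imp_funcset[OF bij] unfolding B3 by blast
qed

end
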